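(* Let $a,b,c$ be arbitrary real numbers, not all zero, and let $\{\mathcal{J}g_{n}^{(3)}\}_{n\geq 0}$ be the generalized Gaussian third-order Jacobsthal sequence with parameters $a,b,c$. For $1-\xi-\xi^{2}-2\xi^{3}\neq 0$, the generating function $g\left(\mathcal{J}g_{n}^{(3)};\xi\right)=\mathcal{J}g_{0}^{(3)}+\mathcal{J}g_{1}^{(3)}\xi+\mathcal{J}g_{2}^{(3)}\xi^{2}+\cdots$ in the variable $\xi$ is given by $$ g\left(\mathcal{J}g_{n}^{(3)};\xi\right)=\frac{a+(b-a)\xi+(c-b-a)\xi^{2}+\frac{1}{2}\left[c-b-a+(3a+b-c)\xi-(a-3b+c)\xi^{2}\right]i}{1-\xi-\xi^{2}-2\xi^{3}}. $$
   Context: Here $i$ is the imaginary unit. The generalized Gaussian third-order Jacobsthal sequence with real parameters $a,b,c$ (not all zero) is the sequence of complex numbers defined by $\mathcal{J}g_{n+3}^{(3)}=\mathcal{J}g_{n+2}^{(3)}+\mathcal{J}g_{n+1}^{(3)}+2\mathcal{J}g_{n}^{(3)}$ for $n\ge 0$, with $\mathcal{J}g_{0}^{(3)}=a+\frac{1}{2}(c-b-a)i$, $\mathcal{J}g_{1}^{(3)}=b+ai$, $\mathcal{J}g_{2}^{(3)}=c+bi$. *)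

theory Defs
  imports Complex_Main "HOL-Computational_Algebra.Formal_Power_Series"
begin

fun gauss_jacobsthal3 :: "real \<Rightarrow> real \<Rightarrow> real \<Rightarrow> nat \<Rightarrow> complex" where
  "gauss_jacobsthal3 a b c 0 = of_real a + of_real ((c - b - a) / 2) * \<i>"
| "gauss_jacobsthal3 a b c (Suc 0) = of_real b + of_real a * \<i>"
| "gauss_jacobsthal3 a b c (Suc (Suc 0)) = of_real c + of_real b * \<i>"
| "gauss_jacobsthal3 a b c (Suc (Suc (Suc n))) =
     gauss_jacobsthal3 a b c (Suc (Suc n)) + gauss_jacobsthal3 a b c (Suc n)
       + 2 * gauss_jacobsthal3 a b c n"

definition gauss_jacobsthal3_gf :: "real \<Rightarrow> real \<Rightarrow> real \<Rightarrow> complex fps" where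
  "gauss_jacobsthal3_gf a b c = Abs_fps (gauss_jacobsthal3 a b c)"

text \<open>Embeds real coefficients into the ring of formal power series over the complex numbers.\<close>
abbreviation fps_real :: "real \<Rightarrow> complex fps" where
  "fps_real r \<equiv> fps_const (complex_of_real r)"

end

theory Submission imports Defs
begin

(* Writing F0, F1, F2, F3 for the generating function of the sequence and of its first three shifts,
   one has Fk = u k + x F(k+1) and F3 = F2 + F1 + 2 F0; eliminating F1, F2, F3 is pure ring algebra,
   so the same computation serves formal power series and convergent numerical series. *)

lemma shifted_generating_functions_eliminate:
  fixes x :: "'a::comm_ring_1"
  assumes "F0 = u0 + x * F1" "F1 = u1 + x * F2" "F2 = u2 + x * F3"
    and "F3 = F2 + F1 + 2 * F0"
  shows "F0 * (1 - x - x ^ 2 - 2 * x ^ 3) = u0 + (u1 - u0) * x + (u2 - u1 - u0) * x ^ 2"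
proof -
  \<comment> \<open>Solving for the initial values instead of the \<open>Fk\<close> removes
    \<open>F3\<close>; after substitution the claim is a polynomial identity in \<open>x\<close>,
    \<open>F0\<close>, \<open>F1\<close>, \<open>F2\<close>.\<close>
  have "u0 = F0 - x * F1" "u1 = F1 - x * F2" "u2 = F2 - x * (F2 + F1 + 2 * F0)"
    using assms unfolding eq_diff_eq by metis+
  then show ?thesis
    by (simp only:) (simp add: algebra_simps power2_eq_square power3_eq_cube)
qed

lemma fps_eq_const_plus_X_times_shift:
  "Abs_fps f = fps_const (f 0) + fps_X * Abs_fps (\<lambda>n. f (Suc n))"
  for f :: "nat \<Rightarrow> 'a::comm_ring_1"
  by (rule fps_ext) (auto simp: fps_X_mult_nth split: nat.split)

text \<open>Elimination at \<open>x = fps_X\<close>, free of convergence questions. The denominator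
  stays multiplied out, so a commutative ring suffices.\<close>

lemma fps_third_order_recurrence:
  fixes u :: "nat \<Rightarrow> 'a::comm_ring_1"
  assumes rec: "\<And>n. u (n + 3) = u (n + 2) + u (n + 1) + 2 * u n"
  shows "Abs_fps u * (1 - fps_X - fps_X ^ 2 - 2 * fps_X ^ 3) =
    fps_const (u 0) + fps_const (u 1 - u 0) * fps_X + fps_const (u 2 - u 1 - u 0) * fps_X ^ 2"
proof -
  define F where "F k = Abs_fps (\<lambda>n. u (n + k))" for k
  have step: "F k = fps_const (u k) + fps_X * F (Suc k)" for k
    unfolding F_def by (subst fps_eq_const_plus_X_times_shift) simp
  have "F 3 = F 2 + F 1 + 2 * F 0"
    by (rule fps_ext) (simp add: F_def rec[simplified] numeral_fps_const)
  then show ?thesis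
    using shifted_generating_functions_eliminate[of "F 0" "fps_const (u 0)" fps_X "F 1"
        "fps_const (u 1)" "F 2" "fps_const (u 2)" "F 3"] step[of 0] step[of 1] step[of 2]
    by (simp add: F_def numeral_2_eq_2 numeral_3_eq_3 flip: fps_const_sub)
qed

text \<open>Elimination at a point \<open>x\<close>. Dropping finitely many terms preserves
  summability, so every shifted series converges too.\<close>

lemma suminf_third_order_recurrence:
  fixes u :: "nat \<Rightarrow> 'a::real_normed_field"
  assumes rec: "\<And>n. u (n + 3) = u (n + 2) + u (n + 1) + 2 * u n"
    and sm: "summable (\<lambda>n. u n * x ^ n)"
  shows "(\<Sum>n. u n * x ^ n) * (1 - x - x ^ 2 - 2 * x ^ 3) =
    u 0 + (u 1 - u 0) * x + (u 2 - u 1 - u 0) * x ^ 2"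
\<comment> \<open>The shifted series come from tails of the original one by division by
  \<open>x ^ k\<close>, so \<open>x = 0\<close> is treated apart.\<close>
proof (cases "x = 0")
  case True
  then show ?thesis by simp
next
  case False
  define F where "F k = (\<Sum>n. u (n + k) * x ^ n)" for k
  have sum: "summable (\<lambda>n. u (n + k) * x ^ n)" for k
  proof -
    have "summable (\<lambda>n. u (n + k) * x ^ (n + k) / x ^ k)"
      using sm summable_iff_shift[of "\<lambda>n. u n * x ^ n" k] by (intro summable_divide) simp
    then show ?thesis using False by (simp add: power_add)
  qed
  have step: "F k = u k + x * F (Suc k)" for k
  proof -
    have "F k = u k + (\<Sum>n. u (Suc n + k) * x ^ Suc n)"
      unfolding F_def using suminf_split_head[OF sum[of k]] by simp
    also have "(\<Sum>n. u (Suc n + k) * x ^ Suc n) = x * F (Suc k)"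
      unfolding F_def using suminf_mult[OF sum[of "Suc k"], of x] by (simp add: ac_simps)
    finally show ?thesis .
  qed
  \<comment> \<open>Writing \<open>u (n + 0)\<close> lets the last summand match \<open>F 0\<close>
    and \<open>sum\<close> at \<open>k = 0\<close>.\<close>
  have "F 3 = (\<Sum>n. u (n + 2) * x ^ n + u (n + 1) * x ^ n + 2 * (u (n + 0) * x ^ n))"
    unfolding F_def rec by (simp add: algebra_simps)
  also have "\<dots> = F 2 + F 1 + 2 * F 0"
    unfolding F_def
    by (intro sums_unique[symmetric] sums_add sums_mult summable_sums sum)
  finally show ?thesis
    using shifted_generating_functions_eliminate[of "F 0" "u 0" x "F 1" "u 1" "F 2" "u 2" "F 3"]
      step[of 0] step[of 1] step[of 2]
    by (simp add: F_def numeral_2_eq_2 numeral_3_eq_3)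
qed

lemma gauss_jacobsthal3_rec:
  "gauss_jacobsthal3 a b c (n + 3) =
    gauss_jacobsthal3 a b c (n + 2) + gauss_jacobsthal3 a b c (n + 1) + 2 * gauss_jacobsthal3 a b c n"
  by (simp add: numeral_2_eq_2 numeral_3_eq_3)

text \<open>Comparing real and imaginary parts of the initial values gives the numerator; for
  instance \<open>b - a - (c - b - a) / 2 = - (a - 3 * b + c) / 2\<close> in the last case.\<close>

lemma gauss_jacobsthal3_numerator_coeffs:
  fixes a b c :: real
  defines "u \<equiv> gauss_jacobsthal3 a b c"
  shows "u 0 = of_real a + of_real (1 / 2) * of_real (c - b - a) * \<i>"
    and "u 1 - u 0 = of_real (b - a) + of_real (1 / 2) * of_real (3 * a + b - c) * \<i>"
    and "u 2 - u 1 - u 0 = of_real (c - b - a) - of_real (1 / 2) * of_real (a - 3 * b + c) * \<i>"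
  by (simp_all add: u_def numeral_2_eq_2 complex_eq_iff field_simps)

text \<open>The generating function is read in two ways: as a formal power series, and as a
  numerical sum at each point where the series converges.\<close>

theorem theorem2p10:
  fixes a b c :: real
  assumes "\<not> (a = 0 \<and> b = 0 \<and> c = 0)"
  shows "(let X = fps_X :: complex fps in
            1 - X - X ^ 2 - 2 * X ^ 3 \<noteq> 0 \<longrightarrow>
            gauss_jacobsthal3_gf a b c =
              (fps_real a + fps_real (b - a) * X + fps_real (c - b - a) * X ^ 2
                + fps_real (1 / 2) *
                  (fps_real (c - b - a) + fps_real (3 * a + b - c) * X
                    - fps_real (a - 3 * b + c) * X ^ 2) * fps_const \<i>)
              / (1 - X - X ^ 2 - 2 * X ^ 3))
       \<and> (\<forall>\<xi> :: complex.
            1 - \<xi> - \<xi> ^ 2 - 2 * \<xi> ^ 3 \<noteq> 0 \<longrightarrow>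
            summable (\<lambda>n. gauss_jacobsthal3 a b c n * \<xi> ^ n) \<longrightarrow>
            (\<Sum>n. gauss_jacobsthal3 a b c n * \<xi> ^ n) =
              (of_real a + of_real (b - a) * \<xi> + of_real (c - b - a) * \<xi> ^ 2
                + of_real (1 / 2) *
                  (of_real (c - b - a) + of_real (3 * a + b - c) * \<xi>
                    - of_real (a - 3 * b + c) * \<xi> ^ 2) * \<i>)
              / (1 - \<xi> - \<xi> ^ 2 - 2 * \<xi> ^ 3))"
proof -
  let ?u = "gauss_jacobsthal3 a b c"
  note coeffs = gauss_jacobsthal3_numerator_coeffs[of a b c]
  let ?D = "1 - fps_X - fps_X ^ 2 - 2 * fps_X ^ 3 :: complex fps"
  let ?N = "fps_real a + fps_real (b - a) * fps_X + fps_real (c - b - a) * fps_X ^ 2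
    + fps_real (1 / 2) * (fps_real (c - b - a) + fps_real (3 * a + b - c) * fps_X
      - fps_real (a - 3 * b + c) * fps_X ^ 2) * fps_const \<i>"
  have "Abs_fps ?u * ?D = ?N"
    \<comment> \<open>The longest difference is rewritten first: expanding \<open>?u 0\<close>
      earlier would destroy the other left-hand sides. Real differences inside
      \<open>of_real\<close> remain atoms when \<open>fps_const\<close> is split.\<close>
    unfolding fps_third_order_recurrence[of ?u, OF gauss_jacobsthal3_rec] coeffs(3)
    unfolding coeffs(2) unfolding coeffs(1)
    unfolding fps_const_add[symmetric] fps_const_sub[symmetric] fps_const_mult[symmetric]
    by (simp only: algebra_simps)
  \<comment> \<open>Formal power series over a field have no zero divisors, so a nonzero
    \<open>?D\<close> cancels from its multiple \<open>?N\<close>.\<close>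
  then have formal: "gauss_jacobsthal3_gf a b c = ?N / ?D" if "?D \<noteq> 0"
    unfolding gauss_jacobsthal3_gf_def using that by (metis nonzero_mult_div_cancel_right)
  have analytic: "(\<Sum>n. ?u n * x ^ n) =
      (of_real a + of_real (b - a) * x + of_real (c - b - a) * x ^ 2
        + of_real (1 / 2) * (of_real (c - b - a) + of_real (3 * a + b - c) * x
          - of_real (a - 3 * b + c) * x ^ 2) * \<i>) / (1 - x - x ^ 2 - 2 * x ^ 3)"
    if "1 - x - x ^ 2 - 2 * x ^ 3 \<noteq> 0" "summable (\<lambda>n. ?u n * x ^ n)" for x :: complex
    unfolding eq_divide_eq suminf_third_order_recurrence[OF gauss_jacobsthal3_rec that(2)] coeffs(3)
    unfolding coeffs(2) unfolding coeffs(1)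
    \<comment> \<open>\<open>eq_divide_eq\<close> leaves a conditional on the denominator being
      nonzero, which \<open>that(1)\<close> resolves.\<close>
    using that(1) by (simp only: if_True not_False_eq_True algebra_simps)
  show ?thesis
    unfolding Let_def using formal analytic by blast
qed

end
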